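(* Let $A$ be a finite set of colours, let $F=\sum_{t\in T_A'}t$ be the characteristic series of the set $T_A'$ of planted rooted ordered $A$-coloured trees, and let $F^*=\sum_{t\in T_A}t$ be the characteristic series of the set $T_A$ of all rooted ordered $A$-coloured trees. Then $F$ and $F^*$ are elements of the restricted dual $(\Bbbk T_A,\,.\,,\Delta)^\circ$ of the Hopf algebra of rooted ordered coloured trees. In particular, $F$ is a primitive element, $$\delta(F)=\bullet\otimes F+F\otimes\bullet,$$ and $F^*$ is group-like, $$\delta(F^* )=F^*\otimes F^* .$$
   Context: $\Bbbk$ is a field of characteristic zero. A rooted ordered tree is a finite rooted tree in which the children of every vertex are totally ordered. A rooted ordered coloured (ROC) tree over a finite set $A$ is a rooted ordered tree with a function from its set of edges to $A$. $T_A$ is the set of ROC trees and $\Bbbk T_A$ is the $\Bbbk$-vector space with basis $T_A$. The trivial tree $\bullet$ has only a root; a planted tree is a non-trivial tree whose root has exactly one child. Product: $t\,.\,s$ is obtained by identifying the roots of $t$ and $s$, placing the branches of $t$ to the left of those of $s$; the unit is $\bullet$. Pruning coproduct: $\Delta(t)=\sum t_c\otimes t_s$ over all subtrees $t_s$ of $t$ containing the root (including $\bullet$ and $t$), where $t_c$ is the concatenation of the planted branches of $t$ pruned to obtain $t_s$, in the order inherited from $t$ (left-to-right depth-first order). The counit is $\epsilon(\bullet)=1$ and $\epsilon(t)=0$ for $t\neq\bullet$. With these operations $\Bbbk T_A$ is a graded connected Hopf algebra. A formal tree series is a linear functional $G\in(\Bbbk T_A)^*$, written $G=\sum_{t\in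 T_A}\langle G,t\rangle t$; a tree $t$ is identified with the functional dual to it. The deconcatenation coproduct of a series is $$\delta(G)=\sum_{t,s\in T_A}\langle G,t\,.\,s\rangle\, t\otimes s\in(\Bbbk T_A\otimes\Bbbk T_A)^*,$$ i.e. the transpose of the product, and $(\Bbbk T_A)^*\otimes(\Bbbk T_A)^*$ is regarded as a subspace of $(\Bbbk T_A\otimes\Bbbk T_A)^*$ via $G_1\otimes G_2=\sum_{t,s}\langle G_1,t\rangle\langle G_2,s\rangle\, t\otimes s$. The restricted (Sweedler) dual $(\Bbbk T_A,\,.\,,\Delta)^\circ$ is the set of $G\in(\Bbbk T_A)^*$ such that $\delta(G)$ is a finite sum $\sum_{i=1}^rG_i\otimes H_i\in(\Bbbk T_A)^*\otimes(\Bbbk T_A)^*$; equivalently, the kernel of $G$ contains an ideal of $\Bbbk T_A$ of finite codimension. *)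

theory Defs
  imports "HOL-Library.Poly_Mapping" "HOL-Library.FuncSet"
begin

section \<open>Rooted ordered coloured trees\<close>

text \<open>
  A tree is the left-to-right list of the branches at its root; a branch consists of the
  colour of the edge leaving the root together with the subtree above that edge.
  Isomorphic trees are thereby equal.
\<close>

datatype (edge_colours: 'a) roc_tree = Node (branches: "('a \<times> 'a roc_tree) list")

definition trees :: "'a set \<Rightarrow> 'a roc_tree set"  where
  "trees A = {t. edge_colours t \<subseteq> A}"

definition trivial_tree :: "'a roc_tree"  (\<open>\<bullet>\<close>) where
  "\<bullet> = Node []"

definition planted_trees :: "'a set \<Rightarrow> 'a roc_tree set" where
  "planted_trees A = {t \<in> trees A. t \<noteq> \<bullet> \<and> length (branches t) = 1}"

definition tree_prod :: "'a roc_tree \<Rightarrow> 'a roc_tree \<Rightarrow> 'a roc_tree"  (infixl \<open>\<odot>\<close> 70) where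
  "t \<odot> s = Node (branches t @ branches s)"


section \<open>Spaces with a basis and their linear duals\<close>

text \<open>
  \<open>free_space B\<close> is the vector space with basis \<open>B\<close>. In particular
  \<open>free_space (trees A \<times> trees A)\<close> is the tensor square of \<open>free_space (trees A)\<close>, the pair
  \<open>(t, s)\<close> standing for the basis vector \<open>t \<otimes> s\<close>.
\<close>

definition free_space :: "'b set \<Rightarrow> ('b \<Rightarrow>\<^sub>0 'k::zero) set" where
  "free_space B = {v. Poly_Mapping.keys v \<subseteq> B}"

text \<open>
  A functional is a function on the carrier \<open>free_space B\<close>; it is made extensional so that
  equality of functionals is equality on this carrier.
\<close>

definition lin_dual :: "'b set \<Rightarrow> (('b \<Rightarrow>\<^sub>0 'k::field) \<Rightarrow> 'k) set" where
  "lin_dual B = {G \<in> extensional (free_space B).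
     (\<forall>v\<in>free_space B. \<forall>w\<in>free_space B. G (v + w) = G v + G w) \<and>
     (\<forall>c. \<forall>v\<in>free_space B. G (Poly_Mapping.map ((*) c) v) = c * G v)}"

definition coefficient :: "(('b \<Rightarrow>\<^sub>0 'k::field) \<Rightarrow> 'k) \<Rightarrow> 'b \<Rightarrow> 'k"  (\<open>\<langle>_,/ _\<rangle>\<close>) where
  "\<langle>G, b\<rangle> = G (Poly_Mapping.single b 1)"

text \<open>
  \<open>series B g\<close> is the functional written as the formal sum of all \<open>g b\<close> times \<open>b\<close>, for
  \<open>b\<close> in \<open>B\<close>: the linear extension of \<open>g\<close>.
\<close>

definition series :: "'b set \<Rightarrow> ('b \<Rightarrow> 'k::field) \<Rightarrow> ('b \<Rightarrow>\<^sub>0 'k) \<Rightarrow> 'k" where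
  "series B g =
     (\<lambda>v\<in>free_space B. \<Sum>b\<in>Poly_Mapping.keys v. Poly_Mapping.lookup v b * g b)"

definition char_series :: "'b set \<Rightarrow> 'b set \<Rightarrow> ('b \<Rightarrow>\<^sub>0 'k::field) \<Rightarrow> 'k" where
  "char_series B S = series B (\<lambda>b. if b \<in> S then 1 else 0)"

definition dual_vector :: "'b set \<Rightarrow> 'b \<Rightarrow> ('b \<Rightarrow>\<^sub>0 'k::field) \<Rightarrow> 'k" where
  "dual_vector B b = char_series B {b}"

definition functional_sum ::
    "'b set \<Rightarrow> 'i set \<Rightarrow> ('i \<Rightarrow> ('b \<Rightarrow>\<^sub>0 'k::field) \<Rightarrow> 'k) \<Rightarrow> ('b \<Rightarrow>\<^sub>0 'k) \<Rightarrow> 'k" where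
  "functional_sum B I f = (\<lambda>v\<in>free_space B. \<Sum>i\<in>I. f i v)"

definition functional_add ::
    "'b set \<Rightarrow> (('b \<Rightarrow>\<^sub>0 'k::field) \<Rightarrow> 'k) \<Rightarrow> (('b \<Rightarrow>\<^sub>0 'k) \<Rightarrow> 'k) \<Rightarrow> ('b \<Rightarrow>\<^sub>0 'k) \<Rightarrow> 'k" where
  "functional_add B f g = (\<lambda>v\<in>free_space B. f v + g v)"

definition tensor ::
    "'b set \<Rightarrow> (('b \<Rightarrow>\<^sub>0 'k::field) \<Rightarrow> 'k) \<Rightarrow> (('b \<Rightarrow>\<^sub>0 'k) \<Rightarrow> 'k) \<Rightarrow> ('b \<times> 'b \<Rightarrow>\<^sub>0 'k) \<Rightarrow> 'k" where
  "tensor B G H = series (B \<times> B) (\<lambda>(t, s). \<langle>G, t\<rangle> * \<langle>H, s\<rangle>)"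


section \<open>Deconcatenation and the restricted dual\<close>

definition deconc ::
    "'a set \<Rightarrow> (('a roc_tree \<Rightarrow>\<^sub>0 'k::field) \<Rightarrow> 'k)
       \<Rightarrow> ('a roc_tree \<times> 'a roc_tree \<Rightarrow>\<^sub>0 'k) \<Rightarrow> 'k" where
  "deconc A G = series (trees A \<times> trees A) (\<lambda>(t, s). \<langle>G, t \<odot> s\<rangle>)"

text \<open>
  The set underlying the restricted (Sweedler) dual of the Hopf algebra of trees. Membership
  depends only on the product of the Hopf algebra; the pruning coproduct determines the product
  of the restricted dual and does not enter here.
\<close>

definition restricted_dual :: "'a set \<Rightarrow> (('a roc_tree \<Rightarrow>\<^sub>0 'k::field) \<Rightarrow> 'k) set" where
  "restricted_dual A = {G \<in> lin_dual (trees A).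
     \<exists>(r::nat) Gs Hs.
       (\<forall>i<r. Gs i \<in> lin_dual (trees A) \<and> Hs i \<in> lin_dual (trees A)) \<and>
       deconc A G =
         functional_sum (trees A \<times> trees A) {..<r} (\<lambda>i. tensor (trees A) (Gs i) (Hs i))}"

end

theory Submission
  imports Defs
begin

text \<open>Both \<open>deconc\<close> and \<open>tensor\<close> are linear extensions of
  coefficient functions on pairs of trees, so by \<open>series_cong\<close> each identity for
  \<delta> can be checked on one pair (t, s) at a time. For F the point is that the number of
  branches at the root is additive under \<odot>: it equals 1 for t \<odot> s exactly when one
  factor is planted and the other is \<bullet> (\<open>tree_prod_in_planted_trees_iff\<close>). For
  F* the point is closure of \<open>trees A\<close> under \<odot>, so both sides have coefficient 1
  everywhere.\<close>

lemma coefficient_series: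
  assumes "b \<in> B"
  shows "\<langle>series B g, b\<rangle> = g b"
  using assms by (simp add: coefficient_def series_def free_space_def)

lemma series_cong:
  assumes "\<And>b. b \<in> B \<Longrightarrow> g b = h b"
  shows "series B g = series B h"
  unfolding series_def free_space_def
  by (intro restrict_ext sum.cong refl) (use assms in auto)

text \<open>Coefficients vanish off the support, so vectors with different supports can be evaluated
  over one common finite index set; linearity then follows termwise.\<close>

lemma series_eq_sum_superset:
  assumes "v \<in> free_space B" "finite S" "Poly_Mapping.keys v \<subseteq> S"
  shows "series B g v = (\<Sum>b\<in>S. Poly_Mapping.lookup v b * g b)"
  unfolding series_def restrict_apply'[OF assms(1)]
  by (rule sum.mono_neutral_left) (use assms in \<open>auto simp: in_keys_iff\<close>)

lemma series_in_lin_dual: "series B g \<in> lin_dual B"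
proof -
  have add: "series B g (v + w) = series B g v + series B g w"
    if v: "v \<in> free_space B" and w: "w \<in> free_space B" for v w
  proof -
    let ?S = "Poly_Mapping.keys v \<union> Poly_Mapping.keys w"
    \<comment> \<open>Only an inclusion: terms of v and w may cancel.\<close>
    have keys: "Poly_Mapping.keys (v + w) \<subseteq> ?S"
      by (rule Poly_Mapping.keys_add)
    then have "v + w \<in> free_space B"
      using v w by (auto simp: free_space_def)
    then show ?thesis
      using v w keys
      by (simp add: series_eq_sum_superset[where S = ?S] lookup_add algebra_simps sum.distrib)
  qed
  have scale: "series B g (Poly_Mapping.map ((*) c) v) = c * series B g v"
    if v: "v \<in> free_space B" for c v
  proof -
    have lookup: "Poly_Mapping.lookup (Poly_Mapping.map ((*) c) v) b = c * Poly_Mapping.lookup v b"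
      for b by (simp add: Poly_Mapping.map.rep_eq when_def)
    \<comment> \<open>Again only an inclusion, since c may be 0.\<close>
    have keys: "Poly_Mapping.keys (Poly_Mapping.map ((*) c) v) \<subseteq> Poly_Mapping.keys v"
      by (auto simp: in_keys_iff lookup)
    then have "Poly_Mapping.map ((*) c) v \<in> free_space B"
      using v by (auto simp: free_space_def)
    then show ?thesis
      using v keys
      by (simp add: series_eq_sum_superset[where S = "Poly_Mapping.keys v"] lookup
          sum_distrib_left mult.assoc)
  qed
  have "series B g \<in> extensional (free_space B)"
    by (simp add: series_def)
  with add scale show ?thesis
    by (simp add: lin_dual_def)
qed

lemma char_series_in_lin_dual: "char_series B S \<in> lin_dual B"
  by (simp add: char_series_def series_in_lin_dual)

lemma coefficient_char_series:
  assumes "b \<in> B"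
  shows "\<langle>char_series B S, b\<rangle> = (if b \<in> S then 1 else 0)"
  using assms by (simp add: char_series_def coefficient_series)

lemma functional_add_series:
  "functional_add B (series B g) (series B h) = series B (\<lambda>b. g b + h b)"
  unfolding functional_add_def series_def
  by (rule restrict_ext) (simp add: sum.distrib algebra_simps)

text \<open>\<open>functional_sum\<close> restricts its result to \<open>free_space B\<close>, so G
  is recovered only if it already takes the default value outside that carrier.\<close>

lemma functional_sum_one:
  assumes "G \<in> extensional (free_space B)"
  shows "functional_sum B {..<1::nat} (\<lambda>i. G) = G"
  using assms by (auto simp: functional_sum_def extensional_def fun_eq_iff)

lemma functional_sum_two:
  "functional_sum B {..<2::nat} f = functional_add B (f 0) (f 1)"
  by (simp add: functional_sum_def functional_add_def numeral_2_eq_2)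

lemma tree_prod_in_trees:
  assumes "t \<in> trees A" "s \<in> trees A"
  shows "t \<odot> s \<in> trees A"
  using assms by (cases t; cases s) (auto simp: trees_def tree_prod_def)

text \<open>Root branches are concatenated, so their numbers add, and 1 splits into naturals only as
  0 + 1 or 1 + 0.\<close>

lemma tree_prod_in_planted_trees_iff:
  assumes "t \<in> trees A" "s \<in> trees A"
  shows "t \<odot> s \<in> planted_trees A \<longleftrightarrow>
    t = \<bullet> \<and> s \<in> planted_trees A \<or> t \<in> planted_trees A \<and> s = \<bullet>"
  using assms tree_prod_in_trees[OF assms]
  by (cases t; cases s)
    (auto simp: planted_trees_def tree_prod_def trivial_tree_def add_is_1)

text \<open>This makes the two cases of the preceding criterion exclusive, so the coefficients of
  \<bullet> \<otimes> F and F \<otimes> \<bullet> never add up to 2.\<close>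

lemma trivial_tree_not_planted: "\<bullet> \<notin> planted_trees A"
  by (simp add: planted_trees_def)

lemma deconc_planted:
  "deconc A (char_series (trees A) (planted_trees A)) =
    functional_add (trees A \<times> trees A)
      (tensor (trees A) (dual_vector (trees A) \<bullet>) (char_series (trees A) (planted_trees A)))
      (tensor (trees A) (char_series (trees A) (planted_trees A)) (dual_vector (trees A) \<bullet>))"
  unfolding deconc_def tensor_def functional_add_series dual_vector_def
  by (rule series_cong)
    (auto simp: coefficient_char_series tree_prod_in_trees tree_prod_in_planted_trees_iff
      trivial_tree_not_planted)

lemma deconc_all_trees:
  "deconc A (char_series (trees A) (trees A)) =
    tensor (trees A) (char_series (trees A) (trees A)) (char_series (trees A) (trees A))"
  unfolding deconc_def tensor_def
  by (rule series_cong) (auto simp: coefficient_char_series tree_prod_in_trees)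

lemma restricted_dual_if_group_like:
  assumes "G \<in> lin_dual (trees A)" "deconc A G = tensor (trees A) G G"
  shows "G \<in> restricted_dual A"
proof -
  have "deconc A G =
      functional_sum (trees A \<times> trees A) {..<1::nat} (\<lambda>i. tensor (trees A) G G)"
    using assms(2) by (subst functional_sum_one) (auto simp: tensor_def series_def)
  then show ?thesis
    unfolding restricted_dual_def using assms(1)
    by (intro CollectI conjI exI[of _ 1] exI[of _ "\<lambda>_. G"]) auto
qed

lemma restricted_dual_if_primitive:
  assumes "G \<in> lin_dual (trees A)"
    and "deconc A G = functional_add (trees A \<times> trees A)
      (tensor (trees A) (dual_vector (trees A) \<bullet>) G)
      (tensor (trees A) G (dual_vector (trees A) \<bullet>))"
  shows "G \<in> restricted_dual A"
proof -
  let ?e = "dual_vector (trees A) \<bullet>"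
  have "?e \<in> lin_dual (trees A)"
    by (simp add: dual_vector_def char_series_in_lin_dual)
  with assms show ?thesis
    unfolding restricted_dual_def
    \<comment> \<open>Index 0 carries the summand \<bullet> \<otimes> G and index 1 the summand G
      \<otimes> \<bullet>.\<close>
    by (intro CollectI conjI exI[of _ 2] exI[of _ "\<lambda>i. if i = 0 then ?e else G"]
        exI[of _ "\<lambda>i. if i = 0 then G else ?e"])
      (auto simp: functional_sum_two)
qed

theorem proposition6p1:
  fixes A :: "'a set"
    and F Fstar :: "('a roc_tree \<Rightarrow>\<^sub>0 'k::field_char_0) \<Rightarrow> 'k"
  assumes "finite A"
    and "F = char_series (trees A) (planted_trees A)"
    and "Fstar = char_series (trees A) (trees A)"
  shows "F \<in> restricted_dual A
    \<and> Fstar \<in> restricted_dual A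
    \<and> deconc A F =
        functional_add (trees A \<times> trees A)
          (tensor (trees A) (dual_vector (trees A) \<bullet>) F)
          (tensor (trees A) F (dual_vector (trees A) \<bullet>))
    \<and> deconc A Fstar = tensor (trees A) Fstar Fstar"
  unfolding assms(2,3)
  by (intro conjI restricted_dual_if_primitive restricted_dual_if_group_like
      char_series_in_lin_dual deconc_planted deconc_all_trees)

end
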